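(* For every integer $k\ge3$ there exist infinitely many (pairwise non-isomorphic) irreducible critically $k$-frustrated signed graphs whose underlying graph is planar.
   Context: A signed graph $(G,\sigma)$ is a finite graph $G$ (loops and multiple edges allowed) with $\sigma:E(G)\to\{+,-\}$. Switching at a vertex $v$ multiplies the signs of all edges at $v$ by $-$. The frustration index $\ell(G,\sigma)$ is the minimum number of negative edges over all signatures obtained from $\sigma$ by switchings. $(G,\sigma)$ is critically $k$-frustrated if $\ell(G,\sigma)=k$ and $\ell(G-e,\sigma)=k-1$ for every edge $e$. A $t$-multiedge $E_{xy}$ is a set of $t$ parallel edges joining distinct vertices $x,y$, all of the same sign. Subdividing at $E_{xy}$: delete $E_{xy}$, add a new vertex $w$, a $t$-multiedge $E_{xw}$ with the sign of $E_{xy}$ and an all-positive $t$-multiedge $E_{wy}$. A subdivision is obtained by a sequence of such operations; a signed graph is irreducible if it is not a proper subdivision of any signed graph. *)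

theory Defs
  imports "HOL-Analysis.Analysis"
begin

datatype sign = Pos | Neg

fun opposite :: "sign \<Rightarrow> sign" where
  "opposite Pos = Neg"
| "opposite Neg = Pos"

text \<open>
  Multigraphs with loops: edges are named objects, and \<open>ends G e\<close> is the set of end vertices of
  the edge \<open>e\<close>, a singleton when \<open>e\<close> is a loop. The values of \<open>ends\<close> and \<open>sgn_of\<close> outside
  \<open>edges G\<close> are irrelevant.
\<close>

record ('v, 'e) sgraph =
  verts :: "'v set"
  edges :: "'e set"
  ends :: "'e \<Rightarrow> 'v set"
  sgn_of :: "'e \<Rightarrow> sign"

definition signed_graph :: "('v, 'e) sgraph \<Rightarrow> bool" where
  "signed_graph G \<longleftrightarrow> finite (verts G) \<and> finite (edges G) \<and>
     (\<forall>e\<in>edges G. \<exists>x\<in>verts G. \<exists>y\<in>verts G. ends G e = {x, y})"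

text \<open>
  Deleting or adding isolated vertices changes neither the frustration index nor criticality, so
  critical signed graphs are taken without them; otherwise adding isolated vertices to one graph
  would already give an infinite family.
\<close>

definition no_isolated_vertices :: "('v, 'e) sgraph \<Rightarrow> bool" where
  "no_isolated_vertices G \<longleftrightarrow> (\<forall>v\<in>verts G. \<exists>e\<in>edges G. v \<in> ends G e)"

definition del_edge :: "('v, 'e) sgraph \<Rightarrow> 'e \<Rightarrow> ('v, 'e) sgraph" where
  "del_edge G e = G\<lparr>edges := edges G - {e}\<rparr>"

definition neg_edges :: "('v, 'e) sgraph \<Rightarrow> 'e set" where
  "neg_edges G = {e \<in> edges G. sgn_of G e = Neg}"

text \<open>
  A loop at \<open>v\<close> meets \<open>v\<close> with both of its ends, so switching at \<open>v\<close> multiplies its sign by \<open>-\<close>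
  twice and leaves it unchanged.
\<close>

definition switch_at :: "'v \<Rightarrow> ('v, 'e) sgraph \<Rightarrow> ('v, 'e) sgraph" where
  "switch_at v G = G\<lparr>sgn_of := \<lambda>e. if v \<in> ends G e \<and> ends G e \<noteq> {v}
                                   then opposite (sgn_of G e) else sgn_of G e\<rparr>"

inductive switching_equiv :: "('v, 'e) sgraph \<Rightarrow> ('v, 'e) sgraph \<Rightarrow> bool" for G where
  refl: "switching_equiv G G"
| switch: "switching_equiv G H \<Longrightarrow> v \<in> verts G \<Longrightarrow> switching_equiv G (switch_at v H)"

definition frustration_index :: "('v, 'e) sgraph \<Rightarrow> nat" where
  "frustration_index G = (LEAST n. \<exists>H. switching_equiv G H \<and> card (neg_edges H) = n)"

definition critically_frustrated :: "nat \<Rightarrow> ('v, 'e) sgraph \<Rightarrow> bool" where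
  "critically_frustrated k G \<longleftrightarrow> frustration_index G = k \<and>
     (\<forall>e\<in>edges G. frustration_index (del_edge G e) + 1 = k)"

definition multiedge :: "('v, 'e) sgraph \<Rightarrow> 'v \<Rightarrow> 'v \<Rightarrow> sign \<Rightarrow> 'e set \<Rightarrow> bool" where
  "multiedge G x y s M \<longleftrightarrow> x \<in> verts G \<and> y \<in> verts G \<and> x \<noteq> y \<and> M \<noteq> {} \<and> M \<subseteq> edges G \<and>
     (\<forall>e\<in>M. ends G e = {x, y} \<and> sgn_of G e = s)"

text \<open>
  \<open>subdivides_to H G\<close>: subdividing \<open>H\<close> at one multiedge \<open>M\<close> gives \<open>G\<close>; \<open>A\<close> and \<open>B\<close> are the new
  multiedges joining the new vertex \<open>w\<close> to \<open>x\<close> and \<open>y\<close>. The names of \<open>w\<close> and of the new edges are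
  arbitrary fresh ones, which makes the relation invariant under isomorphism when the types of
  vertices and edges are infinite.
\<close>

definition subdivides_to :: "('v, 'e) sgraph \<Rightarrow> ('v, 'e) sgraph \<Rightarrow> bool" where
  "subdivides_to H G \<longleftrightarrow> signed_graph H \<and> signed_graph G \<and>
     (\<exists>x y s M w A B.
        multiedge H x y s M \<and> w \<notin> verts H \<and>
        A \<inter> edges H = {} \<and> B \<inter> edges H = {} \<and> A \<inter> B = {} \<and>
        card A = card M \<and> card B = card M \<and>
        verts G = insert w (verts H) \<and> edges G = (edges H - M) \<union> A \<union> B \<and>
        (\<forall>e\<in>edges H - M. ends G e = ends H e \<and> sgn_of G e = sgn_of H e) \<and>
        multiedge G x w s A \<and> multiedge G w y Pos B)"

definition proper_subdivision :: "('v, 'e) sgraph \<Rightarrow> ('v, 'e) sgraph \<Rightarrow> bool" where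
  "proper_subdivision G H \<longleftrightarrow> subdivides_to\<^sup>+\<^sup>+ H G"

text \<open>
  Signed graphs are considered up to switching. Without this, the sign convention in a subdivision
  (one side keeps the sign, the other one is positive) would make an all-negative path through a
  vertex of degree 2 irreducible, although it is a subdivision after one switching.
\<close>

definition irreducible_sgraph :: "('v, 'e) sgraph \<Rightarrow> bool" where
  "irreducible_sgraph G \<longleftrightarrow> \<not> (\<exists>G' H. switching_equiv G G' \<and> proper_subdivision G' H)"

definition isomorphic_sgraph :: "('v, 'e) sgraph \<Rightarrow> ('w, 'f) sgraph \<Rightarrow> bool" where
  "isomorphic_sgraph G H \<longleftrightarrow>
     (\<exists>f g. bij_betw f (verts G) (verts H) \<and> bij_betw g (edges G) (edges H) \<and>
        (\<forall>e\<in>edges G. ends H (g e) = f ` ends G e \<and> sgn_of H (g e) = sgn_of G e))"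

definition switching_isomorphic :: "('v, 'e) sgraph \<Rightarrow> ('w, 'f) sgraph \<Rightarrow> bool" where
  "switching_isomorphic G H \<longleftrightarrow> (\<exists>G'. switching_equiv G G' \<and> isomorphic_sgraph G' H)"

text \<open>
  The underlying graph can be drawn in the plane: \<open>p\<close> places the vertices and \<open>c e\<close> is the curve
  of the edge \<open>e\<close>, an arc for a non-loop and a simple closed curve for a loop.
\<close>

definition planar :: "('v, 'e) sgraph \<Rightarrow> bool" where
  "planar G \<longleftrightarrow> (\<exists>(p :: 'v \<Rightarrow> complex) (c :: 'e \<Rightarrow> real \<Rightarrow> complex).
     inj_on p (verts G) \<and>
     (\<forall>e\<in>edges G. simple_path (c e) \<and> {pathstart (c e), pathfinish (c e)} = p ` ends G e \<and>
        c e ` {0<..<1} \<inter> p ` verts G = {}) \<and>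
     (\<forall>e\<in>edges G. \<forall>f\<in>edges G. e \<noteq> f \<longrightarrow> c e ` {0<..<1} \<inter> c f ` {0<..<1} = {}))"

end

theory Submission
  imports Defs
begin

text \<open>
  For even \<open>m \<ge> 6\<close> the square of the cycle \<open>C\<^sub>m\<close> is an antiprism, hence planar and 4-regular. Make
  negative the three edges that cross one fixed cut between consecutive vertices of the cycle.
  The edges decompose into three negative cycles: \<open>C\<^sub>m\<close> itself and the two \<open>m/2\<close>-gons of steps
  of length 2. So the frustration index is 3, and since switching moves the cut
  around the cycle, every edge is negative in some signature with three negative edges. Every
  further vertex carrying a single negative loop raises the frustration index by one and
  preserves criticality.
\<close>

section \<open>Switching classes as cuts\<close>

text \<open>These are the negative edges after switching once at each vertex of \<open>S\<close>;
  \<open>\<noteq>\<close> acts as exclusive or between the original sign and crossing the cut. A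
  loop never crosses, its set of ends being a singleton.\<close>

definition cut_neg_edges :: "('v, 'e) sgraph \<Rightarrow> 'v set \<Rightarrow> 'e set" where
  "cut_neg_edges G S =
     {e \<in> edges G. (sgn_of G e = Neg) \<noteq> (ends G e \<inter> S \<noteq> {} \<and> \<not> ends G e \<subseteq> S)}"

lemma opposite_eq_Neg_iff: "opposite s = Neg \<longleftrightarrow> s \<noteq> Neg"
  by (cases s) auto

lemma switching_equiv_structure:
  assumes "switching_equiv G H"
  shows "verts H = verts G" "edges H = edges G" "ends H = ends G"
  using assms by (induction) (auto simp: switch_at_def)

text \<open>Toggling \<open>v\<close> in \<open>S\<close> changes the crossing status of exactly the
  non-loop edges at \<open>v\<close>, the same edges whose sign is switched.\<close>

lemma neg_edges_switch_at:
  assumes "signed_graph G" "verts H = verts G" "edges H = edges G" "ends H = ends G"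
    and "neg_edges H = cut_neg_edges G S"
  shows "neg_edges (switch_at v H) = cut_neg_edges G (if v \<in> S then S - {v} else insert v S)"
proof -
  have "e \<in> neg_edges (switch_at v H) \<longleftrightarrow>
      e \<in> cut_neg_edges G (if v \<in> S then S - {v} else insert v S)" if e: "e \<in> edges G" for e
  proof -
    obtain x y where xy: "ends G e = {x, y}"
      using assms(1) e by (auto simp: signed_graph_def)
    have "e \<in> neg_edges H \<longleftrightarrow> e \<in> cut_neg_edges G S"
      using assms(5) by simp
    then show ?thesis
      using e xy assms(2-4)
      by (cases "x = v"; cases "y = v"; cases "x = y"; cases "v \<in> S")
        (auto simp: neg_edges_def cut_neg_edges_def switch_at_def opposite_eq_Neg_iff)
  qed
  moreover have "neg_edges (switch_at v H) \<subseteq> edges G" "cut_neg_edges G T \<subseteq> edges G" for T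
    using assms(3) by (auto simp: neg_edges_def cut_neg_edges_def switch_at_def)
  ultimately show ?thesis
    by blast
qed

lemma neg_edges_switching_equiv:
  assumes "signed_graph G" "switching_equiv G H"
  shows "\<exists>S. neg_edges H = cut_neg_edges G S"
  using assms(2)
proof induction
  case refl
  show ?case by (rule exI[of _ "{}"]) (simp add: neg_edges_def cut_neg_edges_def)
next
  case (switch H v)
  then show ?case
    using neg_edges_switch_at[OF assms(1) switching_equiv_structure[OF switch.hyps(1)]] by blast
qed

text \<open>Switch at the vertices of \<open>S\<close> one at a time. With
  \<open>neg_edges_switching_equiv\<close> this turns the frustration index into a minimum over
  vertex sets.\<close>

lemma switching_equiv_cut:
  assumes "signed_graph G" "S \<subseteq> verts G"
  shows "\<exists>H. switching_equiv G H \<and> neg_edges H = cut_neg_edges G S"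
proof -
  have "finite S"
    using assms finite_subset by (auto simp: signed_graph_def)
  then show ?thesis
    using assms(2)
  proof (induction S)
    case empty
    show ?case
      by (rule exI[of _ G]) (auto simp: neg_edges_def cut_neg_edges_def intro: switching_equiv.refl)
  next
    case (insert v S)
    then obtain H where H: "switching_equiv G H" "neg_edges H = cut_neg_edges G S"
      by auto
    have "switching_equiv G (switch_at v H)"
      using H(1) insert.prems by (auto intro: switching_equiv.switch)
    moreover have "neg_edges (switch_at v H) = cut_neg_edges G (insert v S)"
      using neg_edges_switch_at[OF assms(1) switching_equiv_structure[OF H(1)] H(2), of v]
        insert.hyps by simp
    ultimately show ?case by blast
  qed
qed

lemma frustration_index_le_cut:
  assumes "signed_graph G" "S \<subseteq> verts G"
  shows "frustration_index G \<le> card (cut_neg_edges G S)"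
  unfolding frustration_index_def
  by (rule Least_le) (use switching_equiv_cut[OF assms] in metis)

lemma frustration_index_attained:
  assumes "signed_graph G"
  shows "\<exists>S. frustration_index G = card (cut_neg_edges G S)"
proof -
  have "\<exists>H. switching_equiv G H \<and> card (neg_edges H) = frustration_index G"
    unfolding frustration_index_def
    by (rule LeastI[of _ "card (neg_edges G)"]) (auto intro: switching_equiv.refl)
  then show ?thesis
    using neg_edges_switching_equiv[OF assms] by metis
qed

lemma signed_graph_del_edge: "signed_graph G \<Longrightarrow> signed_graph (del_edge G e)"
  by (auto simp: signed_graph_def del_edge_def)

lemma cut_neg_edges_del_edge: "cut_neg_edges (del_edge G e) S = cut_neg_edges G S - {e}"
  by (auto simp: cut_neg_edges_def del_edge_def)

lemma finite_cut_neg_edges: "signed_graph G \<Longrightarrow> finite (cut_neg_edges G S)"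
  by (auto simp: signed_graph_def cut_neg_edges_def)

text \<open>A certificate for criticality. The sets \<open>X\<close> need only contain the negative
  edges of some switching: deleting \<open>e\<close> leaves at most \<open>k - 1\<close> of them,
  whereas the bound for all cuts can drop by at most one.\<close>

lemma critically_frustratedI:
  assumes G: "signed_graph G" and "edges G \<noteq> {}"
    and lower: "\<And>S. k \<le> card (cut_neg_edges G S)"
    and upper: "\<And>e. e \<in> edges G \<Longrightarrow>
      \<exists>S X. S \<subseteq> verts G \<and> cut_neg_edges G S \<subseteq> X \<and> e \<in> X \<and> finite X \<and> card X \<le> k"
  shows "critically_frustrated k G"
  unfolding critically_frustrated_def
proof (intro conjI ballI antisym)
  obtain e where "e \<in> edges G" using assms(2) by blast
  then obtain S X where "S \<subseteq> verts G" "cut_neg_edges G S \<subseteq> X" "finite X" "card X \<le> k"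
    using upper by meson
  then show "frustration_index G \<le> k"
    using frustration_index_le_cut[OF G] card_mono order_trans by metis
  show "k \<le> frustration_index G"
    using frustration_index_attained[OF G] lower by metis
next
  fix e assume e: "e \<in> edges G"
  then obtain S X where SX: "S \<subseteq> verts G" "cut_neg_edges G S \<subseteq> X" "e \<in> X" "finite X" "card X \<le> k"
    using upper by meson
  have "frustration_index (del_edge G e) \<le> card (cut_neg_edges (del_edge G e) S)"
    using SX(1) by (intro frustration_index_le_cut signed_graph_del_edge G) (simp add: del_edge_def)
  also have "\<dots> \<le> card (X - {e})"
    using SX by (intro card_mono) (auto simp: cut_neg_edges_del_edge)
  finally show "frustration_index (del_edge G e) + 1 \<le> k"
    using SX card_Suc_Diff1[of X e] by simp
  obtain T where T: "frustration_index (del_edge G e) = card (cut_neg_edges G T - {e})"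
    using frustration_index_attained[OF signed_graph_del_edge[OF G]]
    by (auto simp: cut_neg_edges_del_edge)
  have "k \<le> card (cut_neg_edges G T)" by (rule lower)
  also have "\<dots> \<le> card (cut_neg_edges G T - {e}) + 1"
    by (simp add: card_Diff_singleton_if) arith
  finally show "k \<le> frustration_index (del_edge G e) + 1"
    using T by simp
qed

section \<open>The vertex created by a subdivision\<close>

text \<open>The vertex \<open>w\<close> inserted by the last subdivision carries no loop and has no
  neighbours besides \<open>x\<close> and \<open>y\<close>. This obstruction depends only on
  incidences, so it survives switching.\<close>

lemma subdivision_vertex:
  assumes "proper_subdivision G H"
  shows "\<exists>w\<in>verts G. \<exists>x y. x \<noteq> w \<and> y \<noteq> w \<and> (\<exists>e\<in>edges G. w \<in> ends G e) \<and>
           (\<forall>e\<in>edges G. w \<in> ends G e \<longrightarrow> ends G e = {w, x} \<or> ends G e = {w, y})"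
proof -
  \<comment> \<open>Only the last link of the chain of subdivisions matters.\<close>
  obtain K where K: "subdivides_to K G"
    using assms unfolding proper_subdivision_def by (auto elim: tranclp.cases)
  then have "signed_graph K"
    by (simp add: subdivides_to_def)
  from K obtain x y s M w A B where
    w: "w \<notin> verts K" "verts G = insert w (verts K)"
    and E: "edges G = (edges K - M) \<union> A \<union> B"
    and old: "\<forall>e\<in>edges K - M. ends G e = ends K e"
    and A: "multiedge G x w s A" and B: "multiedge G w y Pos B"
    unfolding subdivides_to_def by (elim conjE exE) simp
  have "w \<notin> ends G e" if "e \<in> edges K - M" for e
  proof -
    obtain x' y' where "x' \<in> verts K" "y' \<in> verts K" "ends K e = {x', y'}"
      using \<open>signed_graph K\<close> \<open>e \<in> edges K - M\<close> unfolding signed_graph_def by blast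
    then show ?thesis
      using old w(1) \<open>e \<in> edges K - M\<close> by auto
  qed
  then have "\<forall>e\<in>edges G. w \<in> ends G e \<longrightarrow> ends G e = {w, x} \<or> ends G e = {w, y}"
    using E A B by (auto simp: multiedge_def)
  moreover have "x \<noteq> w" "y \<noteq> w"
    using A B by (auto simp: multiedge_def)
  moreover obtain a where "a \<in> A"
    using A by (auto simp: multiedge_def)
  then have "a \<in> edges G" "w \<in> ends G a"
    using A by (auto simp: multiedge_def)
  ultimately show ?thesis
    using w(2) by blast
qed

section \<open>The cycle squares with loops and their irreducibility\<close>

lemma mod_below_double:
  fixes a m :: nat
  shows "a < 2 * m \<Longrightarrow> a mod m = (if a < m then a else a - m)"
  by (simp add: le_mod_geq)

text \<open>
  For \<open>e < 2 * m\<close>, the edge \<open>e\<close> goes from \<open>e div 2\<close> one step (\<open>e\<close> even) or two steps (\<open>e\<close> odd)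
  around the cycle; it is negative iff it passes from \<open>m - 1\<close> to \<open>0\<close>. The remaining \<open>l\<close> edges are
  loops at the vertices \<open>m, \<dots>, m + l - 1\<close>.
\<close>

definition cycle_square :: "nat \<Rightarrow> nat \<Rightarrow> (nat, nat) sgraph" where
  "cycle_square m l = \<lparr>verts = {..<m + l}, edges = {..<2 * m + l},
     ends = \<lambda>e. if e < 2 * m then {e div 2, (e div 2 + 1 + e mod 2) mod m} else {e - m},
     sgn_of = \<lambda>e. if e + 3 < 2 * m then Pos else Neg\<rparr>"

lemma signed_graph_cycle_square: "m > 0 \<Longrightarrow> signed_graph (cycle_square m l)"
proof -
  assume m: "m > 0"
  let ?G = "cycle_square m l"
  have "\<exists>x\<in>verts ?G. \<exists>y\<in>verts ?G. ends ?G e = {x, y}" if "e \<in> edges ?G" for e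
  proof (cases "e < 2 * m")
    case True
    then have "e div 2 \<in> verts ?G" "(e div 2 + 1 + e mod 2) mod m \<in> verts ?G"
      using m by (auto simp: cycle_square_def trans_less_add1)
    moreover have "ends ?G e = {e div 2, (e div 2 + 1 + e mod 2) mod m}"
      using True by (simp add: cycle_square_def)
    ultimately show ?thesis by blast
  next
    case False
    then have "e - m \<in> verts ?G" "ends ?G e = {e - m, e - m}"
      using that by (auto simp: cycle_square_def)
    then show ?thesis by blast
  qed
  then show ?thesis
    by (simp add: signed_graph_def) (simp add: cycle_square_def)
qed

lemma no_isolated_vertices_cycle_square: "no_isolated_vertices (cycle_square m l)"
  unfolding no_isolated_vertices_def
proof
  fix v assume v: "v \<in> verts (cycle_square m l)"
  show "\<exists>e\<in>edges (cycle_square m l). v \<in> ends (cycle_square m l) e"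
  proof (cases "v < m")
    case True
    then show ?thesis
      by (intro bexI[of _ "2 * v"]) (auto simp: cycle_square_def)
  next
    case False
    then show ?thesis
      using v by (intro bexI[of _ "m + v"]) (auto simp: cycle_square_def)
  qed
qed

text \<open>A vertex of the cycle has too many neighbours to be a subdivision vertex, and each other
  vertex meets only its loop.\<close>

lemma irreducible_cycle_square:
  assumes "m \<ge> 6"
  shows "irreducible_sgraph (cycle_square m l)"
  unfolding irreducible_sgraph_def
proof
  let ?G = "cycle_square m l"
  assume "\<exists>G' H. switching_equiv ?G G' \<and> proper_subdivision G' H"
  then obtain G' H where G': "switching_equiv ?G G'" "proper_subdivision G' H"
    by blast
  have vG: "verts ?G = {..<m + l}" by (simp add: cycle_square_def)
  obtain w x y where w: "w \<in> {..<m + l}" "x \<noteq> w" "y \<noteq> w"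
    and inc: "\<exists>e\<in>edges ?G. w \<in> ends ?G e"
    and nb: "\<And>e. e \<in> edges ?G \<Longrightarrow> w \<in> ends ?G e \<Longrightarrow> ends ?G e = {w, x} \<or> ends ?G e = {w, y}"
    using subdivision_vertex[OF G'(2)] unfolding switching_equiv_structure[OF G'(1)] vG by blast
  show False
  proof (cases "w < m")
    case True
    \<comment> \<open>The predecessor \<open>u\<close> and the two vertices after \<open>w\<close>
      are three distinct neighbours of \<open>w\<close>, while only \<open>x\<close> and
      \<open>y\<close> are available.\<close>
    define u where "u = (if w = 0 then m - 1 else w - 1)"
    have u: "u < m" "(u + 1) mod m = w"
      using True assms by (auto simp: u_def)
    have 1: "{w, (w + 1) mod m} = {w, x} \<or> {w, (w + 1) mod m} = {w, y}"
      using nb[of "2 * w"] True by (auto simp: cycle_square_def)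
    have 2: "{w, (w + 2) mod m} = {w, x} \<or> {w, (w + 2) mod m} = {w, y}"
      using nb[of "2 * w + 1"] True by (auto simp: cycle_square_def)
    have 3: "{w, u} = {w, x} \<or> {w, u} = {w, y}"
      using nb[of "2 * u"] u by (auto simp: cycle_square_def insert_commute)
    have "(w + 1) mod m = (if w + 1 < m then w + 1 else w + 1 - m)"
         "(w + 2) mod m = (if w + 2 < m then w + 2 else w + 2 - m)"
      using True assms by (auto simp: mod_below_double)
    then have "(w + 1) mod m \<noteq> (w + 2) mod m" "(w + 1) mod m \<noteq> u" "(w + 2) mod m \<noteq> u"
       "(w + 1) mod m \<noteq> w" "(w + 2) mod m \<noteq> w" "u \<noteq> w"
      using True assms by (auto simp: u_def split: if_splits)
    then show False
      using 1 2 3 by (auto simp: doubleton_eq_iff)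
  next
    case False
    have "m > 0" using assms by simp
    obtain e where e: "e \<in> edges ?G" "w \<in> ends ?G e" using inc by blast
    have "(e div 2 + 1 + e mod 2) mod m < m" using \<open>m > 0\<close> by simp
    then have "ends ?G e = {w}"
      using e False by (auto simp: cycle_square_def split: if_splits)
    then show False
      using nb[OF e] w by auto
  qed
qed

section \<open>Frustration index and criticality\<close>

lemma chain_membership:
  assumes "\<And>i. i < n \<Longrightarrow> (f i \<in> S) = (f (Suc i) \<in> S)"
  shows "(f 0 \<in> S) = (f n \<in> S)"
  using assms by (induction n) auto

text \<open>The edges \<open>2 * j\<close>, \<open>4 * j + 1\<close> and \<open>4 * j + 3\<close>
  form three edge-disjoint negative cycles, and every switching leaves a negative edge on each. The
  \<open>l\<close> negative loops are untouched by switching.\<close>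

lemma cut_neg_edges_cycle_square_ge:
  assumes "even m" "m \<ge> 6"
  shows "l + 3 \<le> card (cut_neg_edges (cycle_square m l) S)"
proof -
  let ?G = "cycle_square m l"
  let ?N = "cut_neg_edges ?G S"
  \<comment> \<open>Originally positive edges do not wrap around; one that stays positive has both
    ends on the same side of the cut.\<close>
  have fwd: "(e div 2 \<in> S) = (e div 2 + 1 + e mod 2 \<in> S)"
    if "e \<notin> ?N" "e + 3 < 2 * m" for e
  proof -
    have "e div 2 + 1 + e mod 2 < m"
      using that(2) by (cases "even e") (auto elim!: evenE oddE)
    then show ?thesis
      using that by (auto simp: cut_neg_edges_def cycle_square_def)
  qed
  \<comment> \<open>The last three edges wrap around and start negative; becoming positive forces
    their ends onto opposite sides.\<close>
  have bwd: "(e div 2 \<in> S) \<noteq> (e div 2 + 1 + e mod 2 - m \<in> S)"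
    if "e \<notin> ?N" "e + 3 \<ge> 2 * m" "e < 2 * m" for e
  proof -
    have "e div 2 + 1 + e mod 2 \<ge> m"
      using that(2) by (cases "even e") (auto elim!: evenE oddE)
    moreover have "e div 2 < m" "e mod 2 < 2"
      using that(3) by auto
    then have "e div 2 + 1 + e mod 2 < 2 * m"
      using assms(2) by linarith
    ultimately have "(e div 2 + 1 + e mod 2) mod m = e div 2 + 1 + e mod 2 - m"
      by (subst mod_below_double) auto
    then show ?thesis
      using that by (auto simp: cut_neg_edges_def cycle_square_def)
  qed
  obtain n where n: "m = 2 * n" "n \<ge> 3" using assms by auto
  \<comment> \<open>On the long cycle, all edges positive would put \<open>0\<close> and
    \<open>m - 1\<close> on the same side along the path, yet on opposite sides by the closing
    edge.\<close>
  have "\<exists>j<m. 2 * j \<in> ?N"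
  proof (rule ccontr)
    assume "\<not> ?thesis"
    then have no: "2 * j \<notin> ?N" if "j < m" for j using that by blast
    have "(0 \<in> S) = (m - 1 \<in> S)"
      using chain_membership[of "m - 1" "\<lambda>i. i" S] fwd[OF no] by force
    moreover have "m - 1 < m" "2 * (m - 1) + 3 \<ge> 2 * m" "2 * (m - 1) < 2 * m"
      using assms(2) by linarith+
    ultimately show False
      using bwd[OF no[of "m - 1"]] by simp
  qed
  then obtain a where a: "a < m" "2 * a \<in> ?N" by blast
  \<comment> \<open>The same contradiction on the even polygon: \<open>4 * j + 1\<close> is the step
    from \<open>2 * j\<close> to \<open>2 * j + 2\<close>.\<close>
  have "\<exists>j<n. 4 * j + 1 \<in> ?N"
  proof (rule ccontr)
    assume "\<not> ?thesis"
    then have no: "4 * j + 1 \<notin> ?N" if "j < n" for j using that by blast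
    have "(2 * i \<in> S) = (2 * Suc i \<in> S)" if "i < n - 1" for i
    proof -
      have "(4 * i + 1) div 2 = 2 * i" "(4 * i + 1) mod 2 = 1" by presburger+
      then show ?thesis using fwd[OF no[of i]] that n by auto
    qed
    then have "(0 \<in> S) = (2 * (n - 1) \<in> S)"
      using chain_membership[of "n - 1" "\<lambda>i. 2 * i" S] by simp
    moreover have "(4 * (n - 1) + 1) div 2 = 2 * (n - 1)" "(4 * (n - 1) + 1) mod 2 = 1"
      by presburger+
    moreover have "n - 1 < n" "4 * (n - 1) + 1 + 3 \<ge> 2 * m" "4 * (n - 1) + 1 < 2 * m"
      "2 * (n - 1) + 1 + 1 - m = 0"
      using n by linarith+
    ultimately show False
      using bwd[OF no[of "n - 1"]] by metis
  qed
  then obtain b where b: "b < n" "4 * b + 1 \<in> ?N" by blast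
  \<comment> \<open>The odd polygon: \<open>4 * j + 3\<close> is the step from
    \<open>2 * j + 1\<close>, and the closing edge ends at \<open>1\<close>.\<close>
  have "\<exists>j<n. 4 * j + 3 \<in> ?N"
  proof (rule ccontr)
    assume "\<not> ?thesis"
    then have no: "4 * j + 3 \<notin> ?N" if "j < n" for j using that by blast
    have "(2 * i + 1 \<in> S) = (2 * Suc i + 1 \<in> S)" if "i < n - 1" for i
    proof -
      have "(4 * i + 3) div 2 = 2 * i + 1" "(4 * i + 3) mod 2 = 1" by presburger+
      then show ?thesis using fwd[OF no[of i]] that n by auto
    qed
    then have "(1 \<in> S) = (2 * (n - 1) + 1 \<in> S)"
      using chain_membership[of "n - 1" "\<lambda>i. 2 * i + 1" S] by simp
    moreover have "(4 * (n - 1) + 3) div 2 = 2 * (n - 1) + 1" "(4 * (n - 1) + 3) mod 2 = 1"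
      by presburger+
    moreover have "n - 1 < n" "4 * (n - 1) + 3 + 3 \<ge> 2 * m" "4 * (n - 1) + 3 < 2 * m"
      "2 * (n - 1) + 1 + 1 + 1 - m = 1"
      using n by linarith+
    ultimately show False
      using bwd[OF no[of "n - 1"]] by metis
  qed
  then obtain c where c: "c < n" "4 * c + 3 \<in> ?N" by blast
  have loops: "{2 * m..<2 * m + l} \<subseteq> ?N"
    by (auto simp: cut_neg_edges_def cycle_square_def)
  have sub: "{2 * a, 4 * b + 1, 4 * c + 3} \<union> {2 * m..<2 * m + l} \<subseteq> ?N"
    using a b c loops by auto
  \<comment> \<open>Residues modulo 4 separate the three cycles.\<close>
  have "2 * a \<noteq> 4 * b + 1" "2 * a \<noteq> 4 * c + 3" "4 * b + 1 \<noteq> 4 * c + 3"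
    by presburger+
  then have "card {2 * a, 4 * b + 1, 4 * c + 3} = 3" by simp
  moreover have "{2 * a, 4 * b + 1, 4 * c + 3} \<inter> {2 * m..<2 * m + l} = {}"
    using a b c n by auto
  ultimately have "card ({2 * a, 4 * b + 1, 4 * c + 3} \<union> {2 * m..<2 * m + l}) = 3 + l"
    by (subst card_Un_disjoint) auto
  then show ?thesis
    using card_mono[OF finite_cut_neg_edges[OF signed_graph_cycle_square] sub] assms by simp
qed

text \<open>Switching at \<open>0, \<dots>, q\<close> moves the cut to just after \<open>q\<close>.
  It is crossed by both edges starting at \<open>q\<close> and by the long edge starting at the
  predecessor of \<open>q\<close>; adding \<open>2 * m\<close> keeps the subtraction meaningful at
  \<open>q = 0\<close>.\<close>

lemma cut_neg_edges_cycle_square_subset: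
  assumes "m \<ge> 6" "q < m"
  shows "cut_neg_edges (cycle_square m l) {..q} \<subseteq>
    {2 * q, 2 * q + 1, (2 * q + 2 * m - 1) mod (2 * m)} \<union> {2 * m..<2 * m + l}"
proof
  fix e assume e: "e \<in> cut_neg_edges (cycle_square m l) {..q}"
  show "e \<in> {2 * q, 2 * q + 1, (2 * q + 2 * m - 1) mod (2 * m)} \<union> {2 * m..<2 * m + l}"
  proof (cases "e < 2 * m")
    case False
    then show ?thesis using e by (auto simp: cut_neg_edges_def cycle_square_def)
  next
    case True
    have last: "(2 * q + 2 * m - 1) mod (2 * m) = (if q = 0 then 2 * m - 1 else 2 * q - 1)"
      using assms by (subst mod_below_double) auto
    define j where "j = e div 2"
    define d where "d = 1 + e mod 2"
    have jd: "e = 2 * j + (d - 1)" "d = 1 \<or> d = 2"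
      unfolding j_def d_def by presburger+
    have "j < m" using True unfolding j_def by simp
    then have mm: "(j + d) mod m = (if j + d < m then j + d else j + d - m)"
      using jd assms by (subst mod_below_double) auto
    have neg: "(e + 3 \<ge> 2 * m) \<noteq> ((j \<le> q) \<noteq> ((j + d) mod m \<le> q))"
      using e True by (auto simp: cut_neg_edges_def cycle_square_def j_def d_def split: if_splits)
    have "e = 2 * q \<or> e = 2 * q + 1 \<or> e = (if q = 0 then 2 * m - 1 else 2 * q - 1)"
    proof (cases "j + d < m")
      case True
      then have "j \<le> q \<and> q < j + d"
        using neg mm jd by auto
      then show ?thesis
        using jd by auto
    next
      case False
      \<comment> \<open>Wrapping edges start negative and stay so only if they do not cross;
        checking the three of them leaves only values of \<open>q\<close> near the ends of the
        range.\<close>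
      then have "(j \<le> q) = (j + d - m \<le> q)"
        using neg mm jd by auto
      moreover have "(d = 1 \<and> j = m - 1) \<or> (d = 2 \<and> j = m - 1) \<or> (d = 2 \<and> j = m - 2)"
        using False jd \<open>j < m\<close> by linarith
      ultimately show ?thesis
        using jd(1) assms by auto
    qed
    then show ?thesis
      unfolding last by blast
  qed
qed

lemma critically_frustrated_cycle_square:
  assumes "even m" "m \<ge> 6"
  shows "critically_frustrated (l + 3) (cycle_square m l)"
proof (rule critically_frustratedI)
  let ?G = "cycle_square m l"
  show "signed_graph ?G" using assms by (simp add: signed_graph_cycle_square)
  show "edges ?G \<noteq> {}" using assms by (auto simp: cycle_square_def lessThan_empty_iff)
  show "l + 3 \<le> card (cut_neg_edges ?G S)" for S
    by (rule cut_neg_edges_cycle_square_ge[OF assms])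
  fix e assume e: "e \<in> edges ?G"
  \<comment> \<open>Cutting just after the start of \<open>e\<close> makes \<open>e\<close> one of
    the crossing edges. A loop lies in \<open>X\<close> for every \<open>q\<close>, so 0 serves as a
    default.\<close>
  define q where "q = (if e < 2 * m then e div 2 else 0)"
  define X where "X = {2 * q, 2 * q + 1, (2 * q + 2 * m - 1) mod (2 * m)} \<union> {2 * m..<2 * m + l}"
  have q: "q < m" using assms by (auto simp: q_def)
  have "{..q} \<subseteq> verts ?G" using q by (auto simp: cycle_square_def)
  moreover have "cut_neg_edges ?G {..q} \<subseteq> X"
    unfolding X_def by (rule cut_neg_edges_cycle_square_subset[OF assms(2) q])
  moreover have "e \<in> X"
  proof (cases "e < 2 * m")
    case True
    then have "e = 2 * q \<or> e = 2 * q + 1" unfolding q_def by auto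
    then show ?thesis by (auto simp: X_def)
  next
    case False
    then show ?thesis using e by (auto simp: X_def cycle_square_def)
  qed
  moreover have "finite X" by (simp add: X_def)
  moreover have "card X \<le> l + 3"
  proof -
    have "card X \<le> card {2 * q, 2 * q + 1, (2 * q + 2 * m - 1) mod (2 * m)} + card {2 * m..<2 * m + l}"
      unfolding X_def by (rule card_Un_le)
    also have "card {2 * q, 2 * q + 1, (2 * q + 2 * m - 1) mod (2 * m)} \<le> 3"
      by (simp add: card_insert_if)
    finally show ?thesis by simp
  qed
  ultimately show "\<exists>S X. S \<subseteq> verts ?G \<and> cut_neg_edges ?G S \<subseteq> X \<and> e \<in> X \<and> finite X \<and> card X \<le> l + 3"
    by blast
qed

section \<open>Planar drawing on a cylinder\<close>

text \<open>The exponential wraps a cylinder onto the punctured plane: height \<open>r\<close>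
  becomes radius \<open>exp r\<close>, and \<open>t\<close> is an angle in units of
  \<open>2 * pi / m\<close>, hence of period \<open>m\<close>.\<close>

definition cyl :: "nat \<Rightarrow> real \<Rightarrow> real \<Rightarrow> complex" where
  "cyl m r t = exp (Complex r (2 * pi * t / m))"

lemma cyl_eq_iff:
  fixes r r' t t' :: real
  assumes "m > 0"
  shows "cyl m r t = cyl m r' t' \<longleftrightarrow> r = r' \<and> (\<exists>n::int. t = t' + of_int n * real m)"
proof -
  have "(2 * pi * t / m = 2 * pi * t' / m + of_int (2 * n) * pi) = (t = t' + of_int n * real m)"
    for n :: int
  proof -
    have "2 * pi * t' / m + of_int (2 * n) * pi = 2 * pi * (t' + of_int n * real m) / m"
      using assms by (simp add: field_simps)
    then show ?thesis
      using assms by simp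
  qed
  then show ?thesis
    unfolding cyl_def exp_eq by (auto simp: complex_eq_iff)
qed

lemma continuous_on_cyl [continuous_intros]:
  assumes "continuous_on A f" "continuous_on A g"
  shows "continuous_on A (\<lambda>x. cyl m (f x) (g x))"
  \<comment> \<open>For \<open>m = 0\<close> division by zero makes the angle constantly 0.\<close>
  unfolding cyl_def Complex_eq using assms by (cases "m = 0") (auto intro!: continuous_intros)

lemma cyl_add_period: "m > 0 \<Longrightarrow> cyl m r (t + real m) = cyl m r t"
  by (auto simp: cyl_eq_iff intro: exI[of _ 1])

lemma of_int_eq_0_if_abs_less_1: "\<bar>real_of_int n\<bar> < 1 \<Longrightarrow> n = 0"
  by linarith

lemma nat_eq_if_congruent_below:
  fixes i j m :: nat and n :: int
  assumes "i < m" "j < m" "real i = real j + of_int n * real m"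
  shows "i = j"
proof -
  have "real_of_int (int i) = real_of_int (int j + n * int m)"
    using assms(3) by simp
  then have "int i = int j + n * int m"
    by (simp only: of_int_eq_iff)
  then have "int i mod int m = int j mod int m" by simp
  then show ?thesis using assms(1,2) by simp
qed

text \<open>The difference \<open>s - t\<close> is an integer of absolute value below 1, hence 0.
  This separates edges that advance by one unit of angle.\<close>

lemma fractional_congruent:
  fixes s t :: real and i j m :: nat and n :: int
  assumes "0 < s" "s < 1" "0 \<le> t" "t < 1" and "i < m" "j < m"
    and "real i + s = real j + t + of_int n * real m"
  shows "i = j \<and> s = t"
proof -
  have "real_of_int (int j - int i + n * int m) = s - t"
    using assms(7) by simp
  then have "\<bar>real_of_int (int j - int i + n * int m)\<bar> < 1"
    using assms(1-4) by linarith
  then have "int j - int i + n * int m = 0"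
    by (rule of_int_eq_0_if_abs_less_1)
  then have "s = t"
    using \<open>real_of_int (int j - int i + n * int m) = s - t\<close> by simp
  then show ?thesis
    using nat_eq_if_congruent_below[OF assms(5,6), of n] assms(7) by simp
qed

text \<open>Halving all angles reduces steps of length two between vertices of equal parity to unit
  steps on a circle of length \<open>m / 2\<close>. Allowing \<open>t = 0\<close> covers meeting a
  vertex.\<close>

lemma fractional_congruent_even:
  fixes s t :: real and i j m :: nat and n :: int
  assumes "0 < s" "s < 1" "0 \<le> t" "t < 1" and "i < m" "j < m"
    and "even m" "even i = even j"
    and "real i + 2 * s = real j + 2 * t + of_int n * real m"
  shows "i = j \<and> s = t"
proof -
  obtain h where h: "m = 2 * h" using assms(7) by auto
  have "i = 2 * (i div 2) + j mod 2" "j = 2 * (j div 2) + j mod 2"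
    using assms(8) by presburger+
  then have r: "real i = 2 * real (i div 2) + real (j mod 2)"
      "real j = 2 * real (j div 2) + real (j mod 2)"
    by (metis of_nat_add of_nat_mult of_nat_numeral)+
  have "real (i div 2) + s = real (j div 2) + t + of_int n * real h"
    using assms(9) r h by simp
  then have "i div 2 = j div 2 \<and> s = t"
    using assms(1-6) h by (intro fractional_congruent[where m = h and n = n]) auto
  then show ?thesis
    using \<open>i = 2 * (i div 2) + j mod 2\<close> \<open>j = 2 * (j div 2) + j mod 2\<close> by metis
qed

text \<open>
  On the cylinder the even vertices lie at height 0, the odd ones at height 1, and vertex \<open>j\<close>
  has angle \<open>j\<close> (in units of \<open>2\<pi>/m\<close>). Edges \<open>j, j + 1\<close> zigzag between the two heights,
  edges \<open>j, j + 2\<close> are horizontal, and each loop goes once around at a height of its own.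
\<close>

lemma planar_cycle_square:
  assumes "even m" "m \<ge> 6"
  shows "planar (cycle_square m l)"
proof -
  let ?G = "cycle_square m l"
  define par where "par i = (if even i then 0 else 1 :: real)" for i :: nat
  \<comment> \<open>A loop vertex uses its own number, at least 6, as height, clear of the band
    between 0 and 1.\<close>
  define p where "p v = (if v < m then cyl m (par v) (real v) else cyl m (real v) 0)" for v
  define rad where "rad e t = (if e < 2 * m then
      if even e then if even (e div 2) then t else 1 - t else par (e div 2)
      else real (e - m))" for e and t :: real
  define ang where "ang e t = (if e < 2 * m then
      if even e then real (e div 2) + t else real (e div 2) + 2 * t
      else real m * t)" for e and t :: real
  define c where "c e t = cyl m (rad e t) (ang e t)" for e t
  have m: "m > 0" "real m \<ge> 6" using assms by auto
  have par: "par i \<in> {0, 1}" "par i \<le> 1" "par i = par j \<longleftrightarrow> even i = even j" for i j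
    by (auto simp: par_def)
  have edge_cases: "(e < 2 * m \<and> even e) \<or> (e < 2 * m \<and> odd e) \<or> 2 * m \<le> e" for e
    by auto
  have half: "e div 2 < m" if "e < 2 * m" for e
    using that by simp
  have rad_zig: "0 < rad e t" "rad e t < 1" if "e < 2 * m" "even e" "0 < t" "t < 1" for e t
    using that by (auto simp: rad_def)
  have rad_hor: "rad e t = par (e div 2)" if "e < 2 * m" "odd e" for e t
    using that by (simp add: rad_def)
  have rad_loop: "rad e t = real (e - m)" "rad e t \<ge> 6" if "2 * m \<le> e" for e t
    using that assms by (auto simp: rad_def)
  have simple: "simple_path (c e)" for e
    unfolding simple_path_def loop_free_def path_def
  proof (intro conjI ballI impI)
    have "continuous_on {0..1} (rad e)" "continuous_on {0..1} (ang e)"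
      unfolding rad_def ang_def
      by (cases "e < 2 * m"; cases "even e"; cases "even (e div 2)"; simp add: continuous_intros)+
    then show "continuous_on {0..1} (c e)"
      unfolding c_def by (intro continuous_on_cyl)
    fix s t :: real
    assume st: "s \<in> {0..1}" "t \<in> {0..1}" and "c e s = c e t"
    then obtain n :: int where eq: "rad e s = rad e t" "ang e s = ang e t + of_int n * real m"
      using m by (auto simp: c_def cyl_eq_iff)
    consider (zig) "e < 2 * m" "even e" | (hor) "e < 2 * m" "odd e" | (loop) "2 * m \<le> e"
      using edge_cases by blast
    then show "s = t \<or> s = 0 \<and> t = 1 \<or> s = 1 \<and> t = 0"
    proof cases
      case zig
      then show ?thesis using eq(1) by (auto simp: rad_def split: if_splits)
    next
      case hor
      \<comment> \<open>A horizontal edge spans angle 2, less than the period, so it cannot close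
        up.\<close>
      then have *: "of_int n * real m = 2 * (s - t)" using eq(2) by (simp add: ang_def)
      have "\<bar>2 * (s - t)\<bar> \<le> 2" using st by auto
      then have "\<bar>real_of_int n\<bar> * real m \<le> 2"
        using * by (metis abs_mult abs_of_nat)
      moreover have "1 * real m \<le> \<bar>real_of_int n\<bar> * real m" if "n \<noteq> 0"
        using that by (intro mult_right_mono) linarith+
      ultimately have "n = 0" using m by fastforce
      then show ?thesis using * by simp
    next
      case loop
      then have "real m * s = real m * (t + n)" using eq(2) by (simp add: ang_def algebra_simps)
      then have *: "s = t + n" using m by simp
      \<comment> \<open>A loop spans exactly one period, so \<open>n = 1\<close> and
        \<open>n = -1\<close> occur only at its two ends.\<close>
      then have "n = 0 \<or> n = 1 \<or> n = -1" using st by auto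
      then show ?thesis using * st by auto
    qed
  qed
  \<comment> \<open>Since \<open>m\<close> is even, reduction modulo \<open>m\<close> preserves
    parity, so edges past \<open>m - 1\<close> arrive at the right height.\<close>
  have p_mod: "p (i mod m) = cyl m (par i) (real i)" for i
  proof -
    have "par (i mod m) = par i" using assms(1) by (simp add: par(3) dvd_mod_iff)
    moreover have "real i = real m * real (i div m) + real (i mod m)"
      by (metis mult_div_mod_eq of_nat_add of_nat_mult)
    then have "real (i mod m) = real i + of_int (- int (i div m)) * real m"
      by simp
    ultimately show ?thesis
      using m by (auto simp: p_def cyl_eq_iff simp del: of_int_minus)
  qed
  have ends: "{pathstart (c e), pathfinish (c e)} = p ` ends ?G e" for e
  proof -
    consider (zig) "e < 2 * m" "even e" | (hor) "e < 2 * m" "odd e" | (loop) "2 * m \<le> e"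
      using edge_cases by blast
    then show ?thesis
    proof cases
      case zig
      then have "c e 0 = p (e div 2)" "c e 1 = p ((e div 2 + 1) mod m)"
        by (auto simp: p_mod) (auto simp: p_def c_def rad_def ang_def par_def add.commute)
      then show ?thesis
        using zig by (simp add: cycle_square_def pathstart_def pathfinish_def even_iff_mod_2_eq_zero)
    next
      case hor
      then have "c e 0 = p (e div 2)" "c e 1 = p ((e div 2 + 2) mod m)"
        by (auto simp: p_mod) (auto simp: p_def c_def rad_def ang_def par_def add.commute)
      then show ?thesis
        using hor by (simp add: cycle_square_def pathstart_def pathfinish_def odd_iff_mod_2_eq_one)
    next
      case loop
      then have "c e 0 = p (e - m)" "c e 1 = p (e - m)"
        using m cyl_add_period[of m _ 0] by (auto simp: p_def c_def rad_def ang_def)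
      then show ?thesis
        using loop by (simp add: cycle_square_def pathstart_def pathfinish_def)
    qed
  qed
  have inj: "inj_on p (verts ?G)"
  proof (rule inj_onI)
    fix v w assume "p v = p w"
    then show "v = w"
      using m par(2)[of v] par(2)[of w] nat_eq_if_congruent_below[of v m w]
      by (auto simp: p_def cyl_eq_iff split: if_splits)
  qed
  have avoid: "c e s \<noteq> p v" if "0 < s" "s < 1" for e s v
  proof
    assume "c e s = p v"
    then obtain n :: int where eq: "rad e s = (if v < m then par v else real v)"
        "ang e s = (if v < m then real v else 0) + of_int n * real m"
      using m by (auto simp: c_def p_def cyl_eq_iff split: if_splits)
    consider (zig) "e < 2 * m" "even e" | (hor) "e < 2 * m" "odd e" | (loop) "2 * m \<le> e"
      using edge_cases by blast
    then show False
    proof cases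
      case zig
      then show False
        using rad_zig[OF zig that] eq(1) par(1)[of v] m by (auto split: if_splits)
    next
      case hor
      then have v: "v < m" "even (e div 2) = even v"
        using eq(1) rad_hor[OF hor] par(2)[of "e div 2"] m par(3) by (auto split: if_splits)
      have "real (e div 2) + 2 * s = real v + 2 * 0 + of_int n * real m"
        using eq(2) hor v by (simp add: ang_def)
      then show False
        using fractional_congruent_even[of s 0 "e div 2" m v n] that half[OF hor(1)] v assms by auto
    next
      case loop
      then have "\<not> v < m"
        using eq(1) rad_loop[OF loop] par(2)[of v] by (auto split: if_splits)
      then have "s = n" using eq(2) loop m by (simp add: ang_def)
      then show False using that by auto
    qed
  qed
  have disjoint: "e = f" if st: "0 < s" "s < 1" "0 < t" "t < 1" and cc: "c e s = c f t" for e f s t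
  proof -
    obtain n :: int where eq: "rad e s = rad f t" "ang e s = ang f t + of_int n * real m"
      using cc m by (auto simp: c_def cyl_eq_iff)
    have e: "(e < 2 * m \<and> even e) \<or> (e < 2 * m \<and> odd e) \<or> 2 * m \<le> e"
      and f: "(f < 2 * m \<and> even f) \<or> (f < 2 * m \<and> odd f) \<or> 2 * m \<le> f"
      by auto
    \<comment> \<open>Heights separate the kinds of edges: zigzag interiors lie strictly between 0
      and 1, horizontal edges at 0 or 1, loops at 6 or above.\<close>
    have "(e < 2 * m \<and> even e \<and> f < 2 * m \<and> even f) \<or> (e < 2 * m \<and> odd e \<and> f < 2 * m \<and> odd f) \<or>
        (2 * m \<le> e \<and> 2 * m \<le> f)"
      using e f eq(1) rad_zig[of e s] rad_zig[of f t] rad_hor[of e s] rad_hor[of f t]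
        rad_loop[of e s] rad_loop[of f t] par(1)[of "e div 2"] par(1)[of "f div 2"] st
      by (smt (verit) insertE singletonD)
    then consider (zig) "e < 2 * m" "even e" "f < 2 * m" "even f"
      | (hor) "e < 2 * m" "odd e" "f < 2 * m" "odd f" | (loop) "2 * m \<le> e" "2 * m \<le> f"
      by blast
    then show "e = f"
    proof cases
      case zig
      then have "real (e div 2) + s = real (f div 2) + t + of_int n * real m"
        using eq(2) by (simp add: ang_def)
      then have "e div 2 = f div 2"
        using fractional_congruent[of s t "e div 2" m "f div 2" n] st half zig by auto
      then show ?thesis using zig by (metis dvd_mult_div_cancel)
    next
      case hor
      then have "real (e div 2) + 2 * s = real (f div 2) + 2 * t + of_int n * real m"
        using eq(2) by (simp add: ang_def)
      moreover have "even (e div 2) = even (f div 2)"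
        using eq(1) hor rad_hor par(3) by metis
      ultimately have "e div 2 = f div 2"
        using fractional_congruent_even[of s t "e div 2" m "f div 2" n] st half hor assms by auto
      then show ?thesis using hor by (metis odd_two_times_div_two_succ)
    next
      case loop
      then show ?thesis using eq(1) rad_loop[of e s] rad_loop[of f t] by auto
    qed
  qed
  show ?thesis
    unfolding planar_def
    using inj simple ends avoid disjoint
    by (intro exI[of _ p] exI[of _ c] conjI ballI impI) (auto simp: image_iff)
qed

section \<open>The infinite family\<close>

lemma switching_isomorphic_card_verts:
  assumes "switching_isomorphic G H"
  shows "card (verts G) = card (verts H)"
proof -
  obtain G' f where "switching_equiv G G'" "bij_betw f (verts G') (verts H)"
    using assms unfolding switching_isomorphic_def isomorphic_sgraph_def by blast
  then show ?thesis
    using switching_equiv_structure(1) bij_betw_same_card by metis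
qed

theorem mainTheorem16:
  fixes k :: nat
  assumes "k \<ge> 3"
  shows "\<exists>F :: (nat, nat) sgraph set. infinite F \<and>
           (\<forall>G\<in>F. signed_graph G \<and> no_isolated_vertices G \<and> irreducible_sgraph G \<and>
              critically_frustrated k G \<and> planar G) \<and>
           pairwise (\<lambda>G H. \<not> switching_isomorphic G H) F"
proof -
  \<comment> \<open>The cycle length is even and at least 6; the cycle square contributes 3 to the
    frustration index and the loops the remaining \<open>k - 3\<close>. Vertex counts tell the
    members apart.\<close>
  define f where "f n = cycle_square (2 * n + 6) (k - 3)" for n
  have card: "card (verts (f n)) = 2 * n + 6 + (k - 3)" for n
    by (simp add: f_def cycle_square_def)
  have "inj f"
  proof (rule injI)
    fix i j assume "f i = f j"
    then have "card (verts (f i)) = card (verts (f j))" by (rule arg_cong)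
    then show "i = j" unfolding card by simp
  qed
  then have "infinite (range f)"
    by (simp add: finite_image_iff)
  moreover have "signed_graph (f n) \<and> no_isolated_vertices (f n) \<and> irreducible_sgraph (f n) \<and>
      critically_frustrated k (f n) \<and> planar (f n)" for n
    using critically_frustrated_cycle_square[of "2 * n + 6" "k - 3"] assms
    by (simp add: f_def signed_graph_cycle_square no_isolated_vertices_cycle_square
        irreducible_cycle_square planar_cycle_square)
  moreover have "pairwise (\<lambda>G H. \<not> switching_isomorphic G H) (range f)"
  proof (rule pairwiseI)
    fix G H assume "G \<in> range f" "H \<in> range f" "G \<noteq> H"
    then obtain i j where ij: "G = f i" "H = f j" "i \<noteq> j" by blast
    have "card (verts G) \<noteq> card (verts H)"
      unfolding ij(1,2) card using ij(3) by simp
    then show "\<not> switching_isomorphic G H"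
      using switching_isomorphic_card_verts by blast
  qed
  ultimately show ?thesis
    by (intro exI[of _ "range f"]) auto
qed

end
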